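(* Let $N$ be a loop, $H$ a group, $\phi:H\to Sym(N)_1$ a group homomorphism, and $L=N\rtimes_\phi H$. Then the middle nucleus of $L$ is $$N_\mu(L)=\{(x,y)\in N\times H\mid \phi_h(x\phi_y(n))=\phi_h(x)\phi_{hy}(n)\ \text{and}\ \phi_h(x)\in N_\mu(N)\ \text{for all } h\in H,\ n\in N\}.$$
   Context: A loop is a non-empty set with a binary operation such that for all $a,b$ the equations $xa=b$ and $ax=b$ have unique solutions, and there is a two-sided identity $1$. $Sym(N)_1$ is the stabilizer of $1$ in the group of permutations of $N$; write $\phi_h=\phi(h)$. $N\rtimes_\phi H$ is the loop on $N\times H$ with operation $(n_1,h_1)(n_2,h_2)=(n_1\phi_{h_1}(n_2),h_1h_2)$. For a loop $Q$, the middle nucleus is $N_\mu(Q)=\{a\in Q\mid x(ay)=(xa)y\ \forall x,y\in Q\}$. *)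

theory Defs
  imports "HOL-Algebra.Group_Action"
begin

text \<open>Loops live on the record type of HOL-Algebra monoids (carrier, multiplication, unit);
  associativity is not required.\<close>

locale loop =
  fixes G (structure)
  assumes m_closed [intro, simp]:
      "\<lbrakk>x \<in> carrier G; y \<in> carrier G\<rbrakk> \<Longrightarrow> x \<otimes> y \<in> carrier G"
    and one_closed [intro, simp]: "\<one> \<in> carrier G"
    and l_one [simp]: "x \<in> carrier G \<Longrightarrow> \<one> \<otimes> x = x"
    and r_one [simp]: "x \<in> carrier G \<Longrightarrow> x \<otimes> \<one> = x"
    and l_div_ex1: "\<lbrakk>a \<in> carrier G; b \<in> carrier G\<rbrakk> \<Longrightarrow> \<exists>!x. x \<in> carrier G \<and> a \<otimes> x = b"
    and r_div_ex1: "\<lbrakk>a \<in> carrier G; b \<in> carrier G\<rbrakk> \<Longrightarrow> \<exists>!x. x \<in> carrier G \<and> x \<otimes> a = b"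

definition middle_nucleus :: "('a, 'm) monoid_scheme \<Rightarrow> 'a set" where
  "middle_nucleus Q = {a \<in> carrier Q. \<forall>x\<in>carrier Q. \<forall>y\<in>carrier Q.
      x \<otimes>\<^bsub>Q\<^esub> (a \<otimes>\<^bsub>Q\<^esub> y) = (x \<otimes>\<^bsub>Q\<^esub> a) \<otimes>\<^bsub>Q\<^esub> y}"

text \<open>The stabilizer of the unit in the symmetric group on the carrier. As usual for
  \<^const>\<open>BijGroup\<close>, permutations are extensional functions, and the product of \<open>g\<close> and \<open>f\<close>
  is the composition that applies \<open>f\<close> first.\<close>

definition Sym1 :: "('a, 'm) monoid_scheme \<Rightarrow> ('a \<Rightarrow> 'a) monoid" where
  "Sym1 N = (BijGroup (carrier N))
     \<lparr>carrier := stabilizer (BijGroup (carrier N)) (\<lambda>f. f) \<one>\<^bsub>N\<^esub>\<rparr>"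

definition semidirect ::
    "('a, 'm) monoid_scheme \<Rightarrow> ('b \<Rightarrow> 'a \<Rightarrow> 'a) \<Rightarrow> ('b, 'n) monoid_scheme \<Rightarrow> ('a \<times> 'b) monoid" where
  "semidirect N \<phi> H =
     \<lparr>carrier = carrier N \<times> carrier H,
      mult = (\<lambda>(n\<^sub>1, h\<^sub>1) (n\<^sub>2, h\<^sub>2). (n\<^sub>1 \<otimes>\<^bsub>N\<^esub> \<phi> h\<^sub>1 n\<^sub>2, h\<^sub>1 \<otimes>\<^bsub>H\<^esub> h\<^sub>2)),
      one = (\<one>\<^bsub>N\<^esub>, \<one>\<^bsub>H\<^esub>)\<rparr>"

lemma carrier_Sym1_iff:
  "f \<in> carrier (Sym1 N) \<longleftrightarrow>
     f \<in> extensional (carrier N) \<and> bij_betw f (carrier N) (carrier N) \<and> f \<one>\<^bsub>N\<^esub> = \<one>\<^bsub>N\<^esub>"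
  by (auto simp: Sym1_def stabilizer_def BijGroup_def Bij_def)

lemma mult_Sym1:
  assumes "g \<in> carrier (Sym1 N)" "f \<in> carrier (Sym1 N)"
  shows "g \<otimes>\<^bsub>Sym1 N\<^esub> f = compose (carrier N) g f"
  using assms by (auto simp: Sym1_def stabilizer_def BijGroup_def)

lemma (in loop) group_Sym1: "group (Sym1 G)"
proof -
  interpret B: group "BijGroup (carrier G)" by (rule group_BijGroup)
  have "group_action (BijGroup (carrier G)) (carrier G) (\<lambda>f. f)"
    unfolding group_action_def group_hom_def group_hom_axioms_def
    by (auto simp: hom_def B.is_group)
  then have "subgroup (stabilizer (BijGroup (carrier G)) (\<lambda>f. f) \<one>) (BijGroup (carrier G))"
    by (rule group_action.stabilizer_subgroup) simp
  then show ?thesis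
    unfolding Sym1_def by (rule B.subgroup_imp_group)
qed

lemma loop_semidirect:
  assumes "loop N" and "group H" and "\<phi> \<in> hom H (Sym1 N)"
  shows "loop (semidirect N \<phi> H)"
proof -
  interpret N: loop N by fact
  interpret H: group H by fact
  have phi: "bij_betw (\<phi> h) (carrier N) (carrier N)" "\<phi> h \<one>\<^bsub>N\<^esub> = \<one>\<^bsub>N\<^esub>"
    if "h \<in> carrier H" for h
    using that assms(3) carrier_Sym1_iff[of "\<phi> h" N] by (auto simp: hom_def Pi_iff)
  have phi_closed: "\<phi> h n \<in> carrier N" if "h \<in> carrier H" "n \<in> carrier N" for h n
    using phi(1)[OF that(1)] that(2) by (auto simp: bij_betw_def)
  have phi_one: "\<phi> \<one>\<^bsub>H\<^esub> n = n" if "n \<in> carrier N" for n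
  proof -
    interpret S: group "Sym1 N" by (rule N.group_Sym1)
    have "\<phi> \<one>\<^bsub>H\<^esub> = \<one>\<^bsub>Sym1 N\<^esub>"
      using assms(3) by (intro hom_one) (auto simp: H.is_group S.is_group)
    then show ?thesis using that by (simp add: Sym1_def BijGroup_def)
  qed
  show ?thesis
  proof (unfold_locales, goal_cases)
    case (5 a b)
    obtain n h m k where ab: "a = (n, h)" "b = (m, k)" by fastforce
    from 5 ab have mem: "n \<in> carrier N" "h \<in> carrier H" "m \<in> carrier N" "k \<in> carrier H"
      by (auto simp: semidirect_def)
    obtain u where u: "u \<in> carrier N" "n \<otimes>\<^bsub>N\<^esub> u = m"
      and u_unique: "\<And>u'. u' \<in> carrier N \<Longrightarrow> n \<otimes>\<^bsub>N\<^esub> u' = m \<Longrightarrow> u' = u"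
      using N.l_div_ex1[OF mem(1,3)] by metis
    obtain v where v: "v \<in> carrier N" "\<phi> h v = u"
      using u(1) bij_betw_imp_surj_on[OF phi(1)[OF mem(2)]] by (metis imageE)
    define l where "l = inv\<^bsub>H\<^esub> h \<otimes>\<^bsub>H\<^esub> k"
    have l: "l \<in> carrier H" "h \<otimes>\<^bsub>H\<^esub> l = k"
      using mem by (auto simp: l_def H.m_assoc[symmetric])
    have l_unique: "l' = l" if "l' \<in> carrier H" "h \<otimes>\<^bsub>H\<^esub> l' = k" for l'
    proof -
      have "h \<otimes>\<^bsub>H\<^esub> l' = h \<otimes>\<^bsub>H\<^esub> l" using that(2) l(2) by simp
      then show ?thesis using that(1) l(1) mem(2) by simp
    qed
    have v_unique: "v' = v" if "v' \<in> carrier N" "n \<otimes>\<^bsub>N\<^esub> \<phi> h v' = m" for v'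
    proof -
      have "\<phi> h v' = \<phi> h v"
        using u_unique[OF phi_closed[OF mem(2) that(1)] that(2)] v(2) by simp
      then show ?thesis
        using bij_betw_imp_inj_on[OF phi(1)[OF mem(2)]] that(1) v(1) by (simp add: inj_on_eq_iff)
    qed
    show ?case
    proof (rule ex1I[of _ "(v, l)"])
      show "(v, l) \<in> carrier (semidirect N \<phi> H) \<and> a \<otimes>\<^bsub>semidirect N \<phi> H\<^esub> (v, l) = b"
        using u v l by (simp add: ab semidirect_def)
    next
      fix x assume "x \<in> carrier (semidirect N \<phi> H) \<and> a \<otimes>\<^bsub>semidirect N \<phi> H\<^esub> x = b"
      then obtain v' l' where x: "x = (v', l')" and v': "v' \<in> carrier N" and l': "l' \<in> carrier H"
          and nv: "n \<otimes>\<^bsub>N\<^esub> \<phi> h v' = m" and hl: "h \<otimes>\<^bsub>H\<^esub> l' = k"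
        by (auto simp: ab semidirect_def)
      show "x = (v, l)"
        using x l_unique[OF l' hl] v_unique[OF v' nv] by simp
    qed
  next
    case (6 a b)
    obtain n h m k where ab: "a = (n, h)" "b = (m, k)" by fastforce
    from 6 ab have mem: "n \<in> carrier N" "h \<in> carrier H" "m \<in> carrier N" "k \<in> carrier H"
      by (auto simp: semidirect_def)
    define l where "l = k \<otimes>\<^bsub>H\<^esub> inv\<^bsub>H\<^esub> h"
    have l: "l \<in> carrier H" "l \<otimes>\<^bsub>H\<^esub> h = k"
      using mem by (auto simp: l_def H.m_assoc)
    obtain u where u: "u \<in> carrier N" "u \<otimes>\<^bsub>N\<^esub> \<phi> l n = m"
      and u_unique: "\<And>u'. u' \<in> carrier N \<Longrightarrow> u' \<otimes>\<^bsub>N\<^esub> \<phi> l n = m \<Longrightarrow> u' = u"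
      using N.r_div_ex1[OF phi_closed[OF l(1) mem(1)] mem(3)] by metis
    have l_unique: "l' = l" if "l' \<in> carrier H" "l' \<otimes>\<^bsub>H\<^esub> h = k" for l'
    proof -
      have "l' \<otimes>\<^bsub>H\<^esub> h = l \<otimes>\<^bsub>H\<^esub> h" using that(2) l(2) by simp
      then show ?thesis using that(1) l(1) mem(2) by simp
    qed
    show ?case
    proof (rule ex1I[of _ "(u, l)"])
      show "(u, l) \<in> carrier (semidirect N \<phi> H) \<and> (u, l) \<otimes>\<^bsub>semidirect N \<phi> H\<^esub> a = b"
        using u l by (simp add: ab semidirect_def)
    next
      fix x assume "x \<in> carrier (semidirect N \<phi> H) \<and> x \<otimes>\<^bsub>semidirect N \<phi> H\<^esub> a = b"
      then obtain u' l' where x: "x = (u', l')" and u': "u' \<in> carrier N" and l': "l' \<in> carrier H"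
          and un: "u' \<otimes>\<^bsub>N\<^esub> \<phi> l' n = m" and lh: "l' \<otimes>\<^bsub>H\<^esub> h = k"
        by (auto simp: ab semidirect_def)
      have "l' = l" using l' lh by (rule l_unique)
      then show "x = (u, l)" using x u_unique[OF u'] un by simp
    qed
  qed (auto simp: semidirect_def phi(2) phi_closed phi_one)
qed

end

theory Submission
  imports Defs
begin

text \<open>Write \<open>\<phi>\<^sub>h\<close> for \<open>\<phi> h\<close>. Because multiplication in \<open>H\<close> is associative, the pair \<open>(x, y)\<close>
  associates in the middle with \<open>(a, h)\<close> on the left and \<open>(b, k)\<close> on the right exactly if
  \<open>a \<cdot> \<phi>\<^sub>h (x \<cdot> \<phi>\<^sub>y b) = (a \<cdot> \<phi>\<^sub>h x) \<cdot> \<phi>\<^bsub>hy\<^esub> b\<close>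
  in \<open>N\<close>, a condition that does not involve \<open>k\<close>. This single family of equations in \<open>a\<close>, \<open>b\<close>, \<open>h\<close>
  splits in two. For \<open>a = 1\<close> it says that \<open>\<phi>\<^sub>h\<close> distributes over the product of \<open>x\<close> and
  \<open>\<phi>\<^sub>y b\<close>. Granted this, the left-hand side becomes \<open>a \<cdot> (\<phi>\<^sub>h x \<cdot> \<phi>\<^bsub>hy\<^esub> b)\<close>; as \<open>\<phi>\<^bsub>hy\<^esub>\<close>
  is surjective, the element \<open>\<phi>\<^bsub>hy\<^esub> b\<close> is an arbitrary one of \<open>N\<close>, and the equations say that
  \<open>\<phi>\<^sub>h x\<close> lies in the middle nucleus of \<open>N\<close>.\<close>

lemma bij_betw_hom_Sym1:
  assumes "\<phi> \<in> hom H (Sym1 N)" and "h \<in> carrier H"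
  shows "bij_betw (\<phi> h) (carrier N) (carrier N)"
  using assms carrier_Sym1_iff[of "\<phi> h" N] by (auto simp: hom_def Pi_iff)

text \<open>The second components of the two bracketings always agree, so membership is decided in the
  first component, where the \<open>H\<close>-part of the right factor does not occur. The unit of \<open>H\<close> can
  therefore serve as that part.\<close>

lemma mem_middle_nucleus_semidirect_iff:
  assumes "group H" and "x \<in> carrier N" and "y \<in> carrier H"
  shows "(x, y) \<in> middle_nucleus (semidirect N \<phi> H) \<longleftrightarrow>
    (\<forall>a \<in> carrier N. \<forall>h \<in> carrier H. \<forall>b \<in> carrier N.
       a \<otimes>\<^bsub>N\<^esub> \<phi> h (x \<otimes>\<^bsub>N\<^esub> \<phi> y b) = (a \<otimes>\<^bsub>N\<^esub> \<phi> h x) \<otimes>\<^bsub>N\<^esub> \<phi> (h \<otimes>\<^bsub>H\<^esub> y) b)"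
proof -
  interpret H: group H by fact
  show ?thesis
    using assms(2,3) H.one_closed
    by (auto simp: middle_nucleus_def semidirect_def H.m_assoc)
qed

text \<open>Setting \<open>a = 1\<close> determines \<open>g\<close>; then surjectivity of \<open>p\<close> turns the remaining equations into
  associativity with \<open>u\<close> in the middle. In the application \<open>h\<close> is fixed, \<open>u\<close> is \<open>\<phi>\<^sub>h x\<close>, \<open>g\<close> sends
  \<open>b\<close> to \<open>\<phi>\<^sub>h (x \<cdot> \<phi>\<^sub>y b)\<close>, and \<open>p\<close> is \<open>\<phi>\<^bsub>hy\<^esub>\<close>.\<close>

lemma (in loop) twisted_middle_assoc_iff:
  assumes u: "u \<in> carrier G" and surj: "p ` carrier G = carrier G"
    and g: "\<And>b. b \<in> carrier G \<Longrightarrow> g b \<in> carrier G"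
  shows "(\<forall>a \<in> carrier G. \<forall>b \<in> carrier G. a \<otimes> g b = (a \<otimes> u) \<otimes> p b) \<longleftrightarrow>
    (\<forall>b \<in> carrier G. g b = u \<otimes> p b) \<and> u \<in> middle_nucleus G"
    (is "?assoc \<longleftrightarrow> ?split")
proof
  assume assoc: ?assoc
  have g_eq: "g b = u \<otimes> p b" if "b \<in> carrier G" for b
    using bspec[OF bspec[OF assoc one_closed] that] g[OF that] u by simp
  have "a \<otimes> (u \<otimes> c) = (a \<otimes> u) \<otimes> c" if "a \<in> carrier G" and "c \<in> carrier G" for a c
  proof -
    obtain b where "b \<in> carrier G" and "c = p b"
      using surj \<open>c \<in> carrier G\<close> by blast
    then show ?thesis
      using assoc g_eq \<open>a \<in> carrier G\<close> by metis
  qed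
  with g_eq u show ?split
    by (simp add: middle_nucleus_def)
next
  assume split: ?split
  have "p b \<in> carrier G" if "b \<in> carrier G" for b
    using surj that by blast
  with split show ?assoc
    by (simp add: middle_nucleus_def)
qed

theorem theorem3p5:
  fixes N :: "('a, 'm) monoid_scheme"
    and H :: "('b, 'n) monoid_scheme"
    and \<phi> :: "'b \<Rightarrow> 'a \<Rightarrow> 'a"
  assumes "loop N"
    and "group H"
    and "\<phi> \<in> hom H (Sym1 N)"
  shows "middle_nucleus (semidirect N \<phi> H) =
    {(x, y) \<in> carrier N \<times> carrier H.
       \<forall>h \<in> carrier H. \<forall>n \<in> carrier N.
         \<phi> h (x \<otimes>\<^bsub>N\<^esub> \<phi> y n) = \<phi> h x \<otimes>\<^bsub>N\<^esub> \<phi> (h \<otimes>\<^bsub>H\<^esub> y) n \<and>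
         \<phi> h x \<in> middle_nucleus N}"
proof -
  interpret N: loop N by fact
  interpret H: group H by fact
  have surj: "\<phi> h ` carrier N = carrier N" if "h \<in> carrier H" for h
    using bij_betw_hom_Sym1[OF assms(3) that] by (rule bij_betw_imp_surj_on)
  then have closed: "\<phi> h n \<in> carrier N" if "h \<in> carrier H" and "n \<in> carrier N" for h n
    using that by blast
  have "(x, y) \<in> middle_nucleus (semidirect N \<phi> H) \<longleftrightarrow>
      (\<forall>h \<in> carrier H. \<forall>n \<in> carrier N.
         \<phi> h (x \<otimes>\<^bsub>N\<^esub> \<phi> y n) = \<phi> h x \<otimes>\<^bsub>N\<^esub> \<phi> (h \<otimes>\<^bsub>H\<^esub> y) n \<and> \<phi> h x \<in> middle_nucleus N)"
    if x: "x \<in> carrier N" and y: "y \<in> carrier H" for x y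
  proof -
    have split: "(\<forall>a \<in> carrier N. \<forall>n \<in> carrier N.
          a \<otimes>\<^bsub>N\<^esub> \<phi> h (x \<otimes>\<^bsub>N\<^esub> \<phi> y n) = (a \<otimes>\<^bsub>N\<^esub> \<phi> h x) \<otimes>\<^bsub>N\<^esub> \<phi> (h \<otimes>\<^bsub>H\<^esub> y) n) \<longleftrightarrow>
        (\<forall>n \<in> carrier N. \<phi> h (x \<otimes>\<^bsub>N\<^esub> \<phi> y n) = \<phi> h x \<otimes>\<^bsub>N\<^esub> \<phi> (h \<otimes>\<^bsub>H\<^esub> y) n) \<and>
        \<phi> h x \<in> middle_nucleus N"
      if h: "h \<in> carrier H" for h
      by (rule N.twisted_middle_assoc_iff) (simp_all add: closed surj h x y)
    \<comment> \<open>The nucleus condition may move under the quantifier over \<open>n\<close> since \<open>N\<close> contains its unit.\<close>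
    show ?thesis
      unfolding mem_middle_nucleus_semidirect_iff[OF assms(2) x y]
      using split N.one_closed by blast
  qed
  moreover have "middle_nucleus (semidirect N \<phi> H) \<subseteq> carrier N \<times> carrier H"
    by (auto simp: middle_nucleus_def semidirect_def)
  ultimately show ?thesis
    by blast
qed

end
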